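(* Let $K$ be a field of characteristic $0$ and let $M_4(K)$ be the algebra of $4\times 4$ matrices over $K$. Then: (i) $M_4(K)$ has no central polynomial $c(x,y)\in K\langle x,y\rangle$ in two variables of degree $m$ with $1\le m\leq 12$; (ii) $M_4(K)$ has no nonzero polynomial identity $f(x,y)\in K\langle x,y\rangle$ in two variables of degree $\leq 12$.
   Context: $K\langle x,y\rangle$ is the free unital associative $K$-algebra on two noncommuting variables $x,y$; degree means total degree. A polynomial $f(x,y)\in K\langle x,y\rangle$ is a polynomial identity for a $K$-algebra $R$ if $f(r_1,r_2)=0$ for all $r_1,r_2\in R$. A polynomial $c(x,y)\in K\langle x,y\rangle$ is a central polynomial for $R$ if $c(r_1,r_2)$ lies in the center of $R$ for all $r_1,r_2\in R$ but $c$ is not a polynomial identity for $R$. *)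

theory Defs
  imports "HOL-Analysis.Analysis" "HOL-Library.Poly_Mapping"
begin

text \<open>
  The free algebra \<open>K\<langle>x,y\<rangle>\<close> is the monoid algebra over \<open>K\<close> of the free monoid on two letters.
  Lists under concatenation become an additively written monoid, so that
  \<^theory>\<open>HOL-Library.Poly_Mapping\<close> supplies the noncommutative convolution ring structure.
\<close>

instantiation list :: (type) monoid_add
begin

definition zero_list :: "'a list" where "zero_list = []"
definition plus_list :: "'a list \<Rightarrow> 'a list \<Rightarrow> 'a list" where "plus_list u v = u @ v"

instance by standard (simp_all add: zero_list_def plus_list_def)

end

datatype letter = Lx | Ly

type_synonym 'k free_alg2 = "letter list \<Rightarrow>\<^sub>0 'k"

text \<open>The zero polynomial gets total degree \<open>0\<close>.\<close>

definition total_degree :: "'k::zero free_alg2 \<Rightarrow> nat" where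
  "total_degree f = Max (insert 0 (length ` Poly_Mapping.keys f))"

text \<open>
  In \<open>M\<^sub>n(K)\<close>, rendered as \<^typ>\<open>'k^'n^'n\<close>, the product is \<open>**\<close> (not the componentwise \<open>*\<close>), and a
  scalar \<open>c\<close> acts as multiplication by the scalar matrix \<open>mat c\<close>.
\<close>

primrec word_eval :: "'k::field^'n^'n \<Rightarrow> 'k^'n^'n \<Rightarrow> letter list \<Rightarrow> 'k^'n^'n" where
  "word_eval A B [] = mat 1"
| "word_eval A B (l # w) = (case l of Lx \<Rightarrow> A | Ly \<Rightarrow> B) ** word_eval A B w"

definition poly_eval :: "'k::field free_alg2 \<Rightarrow> 'k^'n^'n \<Rightarrow> 'k^'n^'n \<Rightarrow> 'k^'n^'n" where
  "poly_eval f A B =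
     (\<Sum>w\<in>Poly_Mapping.keys f. mat (Poly_Mapping.lookup f w) ** word_eval A B w)"

definition mat_center :: "('k::field^'n^'n) set" where
  "mat_center = {C. \<forall>D. C ** D = D ** C}"

text \<open>The argument \<open>TYPE('n)\<close> fixes the algebra \<open>M\<^sub>n(K)\<close> with \<open>n = CARD('n)\<close>.\<close>

definition polynomial_identity :: "'n::finite itself \<Rightarrow> 'k::field free_alg2 \<Rightarrow> bool" where
  "polynomial_identity _ f \<longleftrightarrow> (\<forall>A B :: 'k^'n^'n. poly_eval f A B = 0)"

definition central_polynomial :: "'n::finite itself \<Rightarrow> 'k::field free_alg2 \<Rightarrow> bool" where
  "central_polynomial N c \<longleftrightarrow>
     (\<forall>A B :: 'k^'n^'n. poly_eval c A B \<in> mat_center) \<and> \<not> polynomial_identity N c"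

text \<open>
  For fixed \<open>A\<close> and \<open>B\<close>, \<open>\<lambda>f. poly_eval f A B\<close> is the unital \<open>K\<close>-algebra homomorphism sending the
  two generators to \<open>A\<close> and \<open>B\<close>.
\<close>

lemma mat_add: "mat (a + b) = mat a + (mat b :: 'k::field^'n^'n)"
  by (simp add: mat_def vec_eq_iff)

lemma mat_mult_entry: "(mat c ** (A :: 'k::field^'n^'n)) $ i $ j = c * A $ i $ j"
  by (simp add: matrix_matrix_mult_def mat_def if_distrib[of "\<lambda>x. x * _"] cong: if_cong)

lemma mult_mat_entry: "((A :: 'k::field^'n^'n) ** mat c) $ i $ j = c * A $ i $ j"
  by (simp add: matrix_matrix_mult_def mat_def if_distrib[of "\<lambda>x. _ * x"] mult.commute cong: if_cong)

lemma mat_commute: "mat c ** (A :: 'k::field^'n^'n) = A ** mat c"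
  by (simp add: vec_eq_iff mat_mult_entry mult_mat_entry)

lemma mat_mult: "mat (a * b) = mat a ** (mat b :: 'k::field^'n^'n)"
  by (simp add: vec_eq_iff mat_mult_entry) (simp add: mat_def)

lemma matrix_add_rdistrib_field: "((A :: 'k::field^'n^'m) + B) ** (C :: 'k^'l^'n) = A ** C + B ** C"
  by (simp add: matrix_matrix_mult_def vec_eq_iff distrib_right sum.distrib)

lemma word_eval_append: "word_eval A B (u @ v) = word_eval A B u ** word_eval A B v"
  by (induction u) (simp_all add: matrix_mul_assoc)

lemma poly_eval_superset:
  assumes "finite S" "Poly_Mapping.keys f \<subseteq> S"
  shows "poly_eval f A B = (\<Sum>w\<in>S. mat (Poly_Mapping.lookup f w) ** word_eval A B w)"
  unfolding poly_eval_def
  by (rule sum.mono_neutral_left)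
     (use assms in \<open>auto simp: vec_eq_iff mat_mult_entry in_keys_iff\<close>)

lemma poly_eval_add: "poly_eval (f + g) A B = poly_eval f A B + poly_eval g A B"
proof -
  let ?S = "Poly_Mapping.keys f \<union> Poly_Mapping.keys g"
  have "poly_eval h A B = (\<Sum>w\<in>?S. mat (Poly_Mapping.lookup h w) ** word_eval A B w)"
    if "Poly_Mapping.keys h \<subseteq> ?S" for h
    by (rule poly_eval_superset) (use that in auto)
  then show ?thesis
    by (simp add: Poly_Mapping.keys_add lookup_add mat_add matrix_add_rdistrib_field sum.distrib)
qed

lemma poly_eval_zero [simp]: "poly_eval 0 A B = 0"
  by (simp add: poly_eval_def)

lemma poly_eval_single:
  "poly_eval (Poly_Mapping.single w c) A B = mat c ** word_eval A B w"
  using poly_eval_superset[of "{w}" "Poly_Mapping.single w c" A B] by simp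

lemma poly_eval_scalar: "poly_eval (Poly_Mapping.single 0 c) A B = mat c"
  by (simp add: poly_eval_single zero_list_def)

lemma poly_eval_one: "poly_eval 1 A B = mat 1"
  by (metis poly_eval_scalar single_one)

lemma poly_eval_generators:
  "poly_eval (Poly_Mapping.single [Lx] 1) A B = A"
  "poly_eval (Poly_Mapping.single [Ly] 1) A B = B"
  by (simp_all add: poly_eval_single)

lemma poly_mapping_single_add_induct [case_names zero add]:
  assumes "P 0" "\<And>w c f. P f \<Longrightarrow> P (Poly_Mapping.single w c + f)"
  shows "P (f :: 'a \<Rightarrow>\<^sub>0 'b::comm_monoid_add)"
proof -
  have "P (\<Sum>w\<in>S. Poly_Mapping.single w (Poly_Mapping.lookup f w))" if "finite S" for S
    using that by (induction S rule: finite_induct) (simp_all add: assms)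
  from this[OF finite_keys[of f]] have
    "P (\<Sum>w\<in>Poly_Mapping.keys f. Poly_Mapping.single w (Poly_Mapping.lookup f w))" .
  moreover have "(\<Sum>w\<in>Poly_Mapping.keys f. Poly_Mapping.single w (Poly_Mapping.lookup f w)) = f"
    by (rule poly_mapping_eqI) (auto simp: lookup_sum lookup_single when_def in_keys_iff)
  ultimately show ?thesis by simp
qed

lemma poly_eval_mult: "poly_eval (f * g) A B = poly_eval f A B ** poly_eval g A B"
proof (induction f rule: poly_mapping_single_add_induct)
  case zero
  then show ?case by simp
next
  case (add u c f)
  have "poly_eval (Poly_Mapping.single u c * g) A B
      = poly_eval (Poly_Mapping.single u c) A B ** poly_eval g A B"
  proof (induction g rule: poly_mapping_single_add_induct)
    case zero
    then show ?case by simp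
  next
    case (add v d g)
    have "mat (c * d) ** word_eval A B (u @ v)
        = (mat c ** word_eval A B u) ** (mat d ** word_eval A B v)"
    proof -
      have "mat (c * d) ** word_eval A B (u @ v)
          = mat c ** (mat d ** word_eval A B u) ** word_eval A B v"
        by (simp add: mat_mult word_eval_append matrix_mul_assoc)
      also have "\<dots> = mat c ** (word_eval A B u ** mat d) ** word_eval A B v"
        by (simp only: mat_commute[of d "word_eval A B u"])
      finally show ?thesis by (simp add: matrix_mul_assoc)
    qed
    then show ?case
      by (simp add: add distrib_left mult_single poly_eval_add poly_eval_single
          plus_list_def matrix_add_ldistrib)
  qed
  then show ?case
    by (simp add: add distrib_right poly_eval_add matrix_add_rdistrib_field)
qed

end

theory Submission
  imports Defs
begin

text \<open>
  It suffices to show that a polynomial \<open>f\<close> of degree at most 12 all of whose values on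
  \<open>4 \<times> 4\<close> matrices are central is constant (\<open>central_values_constant\<close>): a central polynomial is
  such an \<open>f\<close> of positive degree, and a nonzero identity is such an \<open>f\<close> that cannot be constant.

  Substitute a diagonal matrix with entries \<open>t\<close> for \<open>x\<close> and an arbitrary matrix \<open>B\<close> for \<open>y\<close>.
  A word with \<open>b\<close> letters \<open>y\<close> has the form \<open>x\<^sup>a\<^sup>0 y x\<^sup>a\<^sup>1 y \<dots> y x\<^sup>a\<^sup>b\<close>; read it as the commutative monomial
  with exponents \<open>a0, \<dots>, ab\<close> in variables \<open>z\<^sub>0, \<dots>, z\<^sub>b\<close>. The part of \<open>f\<close> of degree \<open>b\<close>
  in \<open>y\<close> thereby becomes a polynomial \<open>p\<close> of degree at most \<open>12 - b\<close>, and it contributes to the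
  \<open>(i, j)\<close> entry of the value the sum, over all walks \<open>v\<^sub>0, \<dots>, v\<^sub>b\<close> from \<open>i\<close> to \<open>j\<close> on
  the four indices, of \<open>p(t v\<^sub>0, \<dots>, t v\<^sub>b)\<close> times the product of the entries of \<open>B\<close> along the walk.
  Off the diagonal everything vanishes for all \<open>B\<close>. Comparing coefficients of monomials in the entries of \<open>B\<close>
  shows: for every directed multigraph with \<open>b\<close> edges on four vertices, the sum of \<open>p\<close> over
  all Eulerian trails with given distinct ends is zero (\<open>path_poly_balanced\<close>).

  These relations force \<open>p = 0\<close> when \<open>1 \<le> b \<le> 6\<close> (\<open>balanced_imp_vanishes\<close>). If a walk is the only trail
  with its edges, then \<open>p\<close> vanishes wherever its arguments coincide as the vertices of that walk do. Vanishing on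
  \<open>z\<^sub>i = z\<^sub>j\<close> gives a factor \<open>z\<^sub>i - z\<^sub>j\<close>, so a restriction of \<open>p\<close> that vanishes on more such
  hyperplanes than its degree is zero. Starting from restrictions to few variables, one works up
  to \<open>p\<close> itself; a relation between several trails becomes usable once all but one of its
  terms are known to vanish.

  This kills the coefficient of every word with between one and six letters \<open>y\<close>, and exchanging \<open>x\<close> and \<open>y\<close>
  that of every word with between one and six letters \<open>x\<close>. In degree at most 12 every word containing both
  letters is of one of these kinds. Powers of a single letter are excluded by comparing two diagonal entries.
\<close>

section \<open>Polynomial functions and linear factors\<close>

text \<open>
  \<open>poly_below n f\<close>: the function \<open>f\<close> is given by a polynomial of degree less than \<open>n\<close> in finitely many of
  the variables \<open>z 0, z 1, \<dots>\<close>. The strict bound makes the case \<open>n = 0\<close> say that \<open>f\<close> is zero, which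
  is how a degree count ends.
\<close>

inductive poly_below :: "nat \<Rightarrow> ((nat \<Rightarrow> 'k::field) \<Rightarrow> 'k) \<Rightarrow> bool" where
  zero: "poly_below n (\<lambda>_. 0)"
| const: "poly_below (Suc n) (\<lambda>_. c)"
| var: "poly_below n f \<Longrightarrow> poly_below (Suc n) (\<lambda>z. z i * f z)"
| add: "poly_below n f \<Longrightarrow> poly_below n g \<Longrightarrow> poly_below n (\<lambda>z. f z + g z)"

lemma poly_below_0: "poly_below 0 f \<Longrightarrow> f z = 0"
  by (induction "0::nat" f rule: poly_below.induct) auto

lemma poly_below_scale: "poly_below n f \<Longrightarrow> poly_below n (\<lambda>z. c * f z)"
proof (induction rule: poly_below.induct)
  case (zero n)
  then show ?case by (simp add: poly_below.zero)
next
  case (const n d)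
  then show ?case by (rule poly_below.const)
next
  case (var n f i)
  from poly_below.var[OF var.IH, of i] show ?case by (simp add: mult.left_commute)
next
  case (add n f g)
  from poly_below.add[OF add.IH] show ?case by (simp add: distrib_left)
qed

lemma poly_below_mono: "poly_below m f \<Longrightarrow> m \<le> n \<Longrightarrow> poly_below n f"
proof (induction arbitrary: n rule: poly_below.induct)
  case (const m c)
  then obtain n' where "n = Suc n'" by (cases n) auto
  then show ?case by (simp add: poly_below.const)
next
  case (var m f i)
  then obtain n' where "n = Suc n'" "m \<le> n'" by (cases n) auto
  then show ?case using var.IH by (simp add: poly_below.var)
qed (auto intro: poly_below.intros)

lemma poly_below_sum:
  "finite S \<Longrightarrow> (\<And>w. w \<in> S \<Longrightarrow> poly_below n (f w)) \<Longrightarrow> poly_below n (\<lambda>z. \<Sum>w\<in>S. f w z)"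
  by (induction S rule: finite_induct) (auto intro: poly_below.intros)

lemma poly_below_monomial: "poly_below (Suc (length l)) (\<lambda>z. prod_list (map z l))"
  by (induction l) (auto intro: poly_below.const[where c=1] poly_below.var)

lemma poly_below_subst:
  assumes "poly_below n f" and "\<And>i. s i = (\<lambda>w. 0) \<or> (\<exists>k. s i = (\<lambda>w. w k))"
  shows "poly_below n (\<lambda>w. f (\<lambda>i. s i w))"
  using assms(1)
proof (induction rule: poly_below.induct)
  case (var n f i)
  from assms(2)[of i] show ?case
  proof
    assume "s i = (\<lambda>w. 0)"
    then show ?thesis by (simp add: poly_below.zero)
  next
    assume "\<exists>k. s i = (\<lambda>w. w k)"
    then show ?thesis using var.IH by (auto intro: poly_below.var)
  qed
qed (auto intro: poly_below.intros)

lemma poly_below_line: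
  "poly_below n f \<Longrightarrow> \<exists>q :: 'k::field poly. \<forall>t. f (u(i := t)) = poly q t"
proof (induction rule: poly_below.induct)
  case (zero n)
  show ?case by (rule exI[of _ 0]) simp
next
  case (const n c)
  show ?case by (rule exI[of _ "[:c:]"]) simp
next
  case (var n f k)
  then obtain q where q: "\<forall>t. f (u(i := t)) = poly q t" by blast
  show ?case
    using q by (intro exI[of _ "(if k = i then [:0, 1:] else [:u k:]) * q"]) (simp add: fun_upd_def)
next
  case (add n f g)
  then obtain q r where "\<forall>t. f (u(i := t)) = poly q t" "\<forall>t. g (u(i := t)) = poly r t" by blast
  then show ?case by (intro exI[of _ "q + r"]) (simp add: fun_upd_def)
qed

text \<open>
  On the line through a point in direction of the \<open>i\<close>-th axis, \<open>f\<close> is a univariate polynomial with zeros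
  everywhere except possibly where the coordinate \<open>i\<close> equals the coordinate \<open>j\<close>; over an infinite field it is zero.
\<close>

lemma poly_below_cancel:
  fixes f :: "(nat \<Rightarrow> 'k::field_char_0) \<Rightarrow> 'k"
  assumes f: "poly_below n f" and ij: "i \<noteq> j" and z: "\<And>z. (z i - z j) * f z = 0"
  shows "f z = 0"
proof -
  obtain q where q: "\<forall>t. f (z(i := t)) = poly q t"
    using poly_below_line[OF f] by blast
  have "poly q t = 0" if "t \<noteq> z j" for t
    using z[of "z(i := t)"] ij that q by auto
  then have "UNIV - {z j} \<subseteq> {t. poly q t = 0}" by auto
  moreover have "infinite (UNIV - {z j} :: 'k set)"
    by (simp add: infinite_UNIV_char_0)
  ultimately have "q = 0"
    using poly_roots_finite[of q] finite_subset by blast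
  then show ?thesis using q[rule_format, of "z i"] by simp
qed

text \<open>
  This is divisibility of \<open>f(\<dots>, z\<^sub>i, \<dots>) - f(\<dots>, z\<^sub>j, \<dots>)\<close> by \<open>z\<^sub>i - z\<^sub>j\<close>, with the drop in degree recorded.
  Working with functions, the quotient is built along the generation of \<open>f\<close>.
\<close>

lemma difference_quotient:
  "poly_below n f \<Longrightarrow> \<exists>g. poly_below (n - 1) g \<and> (\<forall>z. f z - f (z(i := z j)) = (z i - z j) * g z)"
proof (induction rule: poly_below.induct)
  case (zero n)
  show ?case by (rule exI[of _ "\<lambda>_. 0"]) (simp add: poly_below.zero)
next
  case (const n c)
  show ?case by (rule exI[of _ "\<lambda>_. 0"]) (simp add: poly_below.zero)
next
  case (add n f g)
  then obtain f' g' where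
    "poly_below (n - 1) f'" "\<forall>z. f z - f (z(i := z j)) = (z i - z j) * f' z"
    "poly_below (n - 1) g'" "\<forall>z. g z - g (z(i := z j)) = (z i - z j) * g' z" by blast
  then show ?case
    by (intro exI[of _ "\<lambda>z. f' z + g' z"]) (simp add: poly_below.add distrib_left add_diff_add fun_upd_def)
next
  case (var n f k)
  then obtain g where g: "poly_below (n - 1) g" "\<forall>z. f z - f (z(i := z j)) = (z i - z j) * g z"
    by blast
  have vg: "poly_below n (\<lambda>z. z l * g z)" for l
  proof (cases n)
    case 0
    then show ?thesis using g(1) by (simp add: poly_below_0 poly_below.zero)
  next
    case (Suc m)
    then show ?thesis using g(1) by (simp add: poly_below.var)
  qed
  show ?case
  proof (cases "k = i")
    case True
    have "z i * f z - z j * f (z(i := z j)) = (z i - z j) * (f z + z j * g z)" for z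
    proof -
      have "z i * f z - z j * f (z(i := z j)) = (z i - z j) * f z + z j * (f z - f (z(i := z j)))"
        by (simp add: algebra_simps)
      then show ?thesis using g(2) by (simp add: algebra_simps)
    qed
    then show ?thesis using True var.hyps vg[of j]
      by (intro exI[of _ "\<lambda>z. f z + z j * g z"]) (auto intro: poly_below.add simp: fun_upd_def)
  next
    case False
    then have "z k * f z - (z(i := z j)) k * f (z(i := z j)) = (z i - z j) * (z k * g z)" for z
      using g(2)[rule_format, of z] by (simp add: mult.left_commute flip: right_diff_distrib)
    then show ?thesis using vg[of k] by (intro exI[of _ "\<lambda>z. z k * g z"]) (simp add: fun_upd_def)
  qed
qed

definition pair_product :: "(nat \<times> nat) list \<Rightarrow> (nat \<Rightarrow> 'k::comm_ring_1) \<Rightarrow> 'k" where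
  "pair_product S z = (\<Prod>(i, j)\<leftarrow>S. z i - z j)"

lemma pair_product_simps [simp]:
  "pair_product [] z = 1"
  "pair_product ((i, j) # S) z = (z i - z j) * pair_product S z"
  by (simp_all add: pair_product_def)

lemma pair_product_cancel:
  fixes f :: "(nat \<Rightarrow> 'k::field_char_0) \<Rightarrow> 'k"
  assumes "poly_below n f" "\<And>z. pair_product S z * f z = 0" "\<forall>(i, j)\<in>set S. i \<noteq> j"
  shows "f z = 0"
  using assms(2,3)
proof (induction S arbitrary: z)
  case Nil
  then show ?case by simp
next
  case (Cons ij S)
  obtain i j where [simp]: "ij = (i, j)" by force
  have ij: "i \<noteq> j" using Cons.prems(2) by auto
  have "pair_product S z * f z = 0" for z
  proof -
    have "\<exists>m. poly_below m (\<lambda>z. pair_product S z * f z)"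
    proof (induction S)
      case Nil
      then show ?case using assms(1) by auto
    next
      case (Cons ab S)
      then obtain m where m: "poly_below m (\<lambda>z. pair_product S z * f z)" by blast
      obtain a b where [simp]: "ab = (a, b)" by force
      have "poly_below (Suc m) (\<lambda>z. z a * (pair_product S z * f z) + (-1) * (z b * (pair_product S z * f z)))"
        by (intro poly_below.add poly_below_scale poly_below.var m)
      then show ?case by (auto simp: algebra_simps)
    qed
    then obtain m where "poly_below m (\<lambda>z. pair_product S z * f z)" by blast
    from poly_below_cancel[OF this ij] Cons.prems(1) show ?thesis by (simp add: mult.assoc)
  qed
  then show ?case using Cons.IH Cons.prems(2) by simp
qed

text \<open>
  Different differences \<open>z\<^sub>i - z\<^sub>j\<close> are coprime: after one of them has been split off, the others still vanish
  on the quotient because the factor removed is generically nonzero on their hyperplanes.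
\<close>

lemma factor_pairs:
  fixes f :: "(nat \<Rightarrow> 'k::field_char_0) \<Rightarrow> 'k"
  assumes "poly_below n f" "distinct S" "\<forall>(i, j)\<in>set S. i < j"
    "\<forall>(i, j)\<in>set S. \<forall>z. f (z(i := z j)) = 0"
  shows "\<exists>g. poly_below (n - length S) g \<and> (\<forall>z. f z = pair_product S z * g z)"
  using assms
proof (induction S arbitrary: n f)
  case Nil
  then show ?case by auto
next
  case (Cons ij S)
  obtain i j where ij [simp]: "ij = (i, j)" by force
  obtain g where g: "poly_below (n - 1) g" "\<forall>z. f z - f (z(i := z j)) = (z i - z j) * g z"
    using difference_quotient[OF Cons.prems(1)] by blast
  have fg: "f z = (z i - z j) * g z" for z
    using g(2)[rule_format, of z] Cons.prems(4) by (simp add: fun_upd_def)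
  have "g (z(k := z l)) = 0" if kl: "(k, l) \<in> set S" for k l z
  proof -
    let ?\<rho> = "\<lambda>a. if a = k then l else a"
    let ?h = "\<lambda>z. g (\<lambda>a. z (?\<rho> a))"
    have h: "poly_below (n - 1) ?h"
      by (rule poly_below_subst[OF g(1)]) auto
    have upd: "(\<lambda>a. z (?\<rho> a)) = z(k := z l)" for z by auto
    have ne: "?\<rho> i \<noteq> ?\<rho> j"
    proof -
      have "i < j" "k < l" "(i, j) \<noteq> (k, l)" using Cons.prems kl by auto
      then show ?thesis by auto
    qed
    have "(z (?\<rho> i) - z (?\<rho> j)) * ?h z = 0" for z
    proof -
      have "f (z(k := z l)) = 0" using Cons.prems(4) kl by (auto simp: fun_upd_def)
      then show ?thesis using fg[of "z(k := z l)"] unfolding upd by (auto split: if_splits)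
    qed
    from poly_below_cancel[OF h ne this, of z] show ?thesis by (simp only: upd)
  qed
  then obtain h where "poly_below (n - 1 - length S) h" "\<forall>z. g z = pair_product S z * h z"
    using Cons.IH[OF g(1)] Cons.prems by fastforce
  then show ?case using fg by (intro exI[of _ h]) (simp add: mult.assoc)
qed

section \<open>Vanishing on patterns of equal arguments\<close>

text \<open>
  A list of labels \<open>\<sigma>\<close> stands for the linear subspace on which arguments at positions with equal labels coincide,
  and \<open>spread \<sigma> w\<close> is its point with the value \<open>w l\<close> at the positions labelled \<open>l\<close>. Positions beyond the list
  get \<open>0\<close>, so that functions on all sequences can be used for any number of arguments.
\<close>

definition spread :: "nat list \<Rightarrow> (nat \<Rightarrow> 'k::zero) \<Rightarrow> nat \<Rightarrow> 'k" where
  "spread \<sigma> w i = (if i < length \<sigma> then w (\<sigma> ! i) else 0)"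

definition vanishes :: "((nat \<Rightarrow> 'k::zero) \<Rightarrow> 'k) \<Rightarrow> nat list \<Rightarrow> bool" where
  "vanishes f \<sigma> \<longleftrightarrow> (\<forall>w. f (spread \<sigma> w) = 0)"

definition identify :: "nat \<Rightarrow> nat \<Rightarrow> nat list \<Rightarrow> nat list" where
  "identify i j \<sigma> = map (\<lambda>l. if l = i then j else l) \<sigma>"

lemma spread_map: "spread (map \<rho> \<sigma>) w = spread \<sigma> (\<lambda>l. w (\<rho> l))"
  by (auto simp: spread_def)

lemma spread_identify: "spread (identify i j \<sigma>) w = spread \<sigma> (w(i := w j))"
  unfolding identify_def spread_map by (rule arg_cong[of _ _ "spread \<sigma>"]) auto

lemma poly_below_spread:
  assumes "poly_below n f"
  shows "poly_below n (\<lambda>w. f (spread \<sigma> w))"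
proof -
  let ?s = "\<lambda>i w. if i < length \<sigma> then w (\<sigma> ! i) else 0"
  have "?s i = (\<lambda>w. 0) \<or> (\<exists>k. ?s i = (\<lambda>w. w k))" for i
    by (cases "i < length \<sigma>") auto
  from poly_below_subst[OF assms this] show ?thesis by (simp only: spread_def[abs_def])
qed

lemma vanishes_map: "vanishes f \<sigma> \<Longrightarrow> vanishes f (map \<rho> \<sigma>)"
  by (simp add: vanishes_def spread_map)

definition coarser :: "nat list \<Rightarrow> nat list \<Rightarrow> bool" where
  "coarser \<tau> \<sigma> \<longleftrightarrow> length \<tau> = length \<sigma> \<and>
     list_all (\<lambda>(a, b). list_all (\<lambda>(c, d). a = c \<longrightarrow> b = d) (zip \<sigma> \<tau>)) (zip \<sigma> \<tau>)"

lemma vanishes_coarser: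
  assumes "vanishes f \<sigma>" "coarser \<tau> \<sigma>"
  shows "vanishes f \<tau>"
proof -
  have len: "length \<tau> = length \<sigma>" 
    and fn: "\<And>a b d. (a, b) \<in> set (zip \<sigma> \<tau>) \<Longrightarrow> (a, d) \<in> set (zip \<sigma> \<tau>) \<Longrightarrow> b = d"
    using assms(2) unfolding coarser_def list_all_iff by fastforce+
  define \<rho> where "\<rho> a = (THE b. (a, b) \<in> set (zip \<sigma> \<tau>))" for a
  have "\<rho> (\<sigma> ! i) = \<tau> ! i" if "i < length \<sigma>" for i
  proof -
    have "(\<sigma> ! i, \<tau> ! i) \<in> set (zip \<sigma> \<tau>)" using that len by (auto simp: set_zip)
    then show ?thesis unfolding \<rho>_def using fn by blast
  qed
  then have "map \<rho> \<sigma> = \<tau>" using len by (intro nth_equalityI) auto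
  then show ?thesis using vanishes_map[OF assms(1)] by metis
qed

text \<open>
  A restriction of \<open>f\<close> that vanishes on at least as many hyperplanes \<open>z\<^sub>i = z\<^sub>j\<close> as its degree bound is
  divisible by a product of too large degree.
\<close>

lemma vanishes_by_degree:
  fixes f :: "(nat \<Rightarrow> 'k::field_char_0) \<Rightarrow> 'k"
  assumes f: "poly_below n f" and S: "distinct S" "\<forall>(i, j)\<in>set S. i < j \<and> vanishes f (identify i j \<sigma>)"
    and n: "n \<le> length S"
  shows "vanishes f \<sigma>"
proof -
  have "\<exists>g. poly_below (n - length S) g \<and> (\<forall>z. f (spread \<sigma> z) = pair_product S z * g z)"
    using S by (intro factor_pairs[OF poly_below_spread[OF f]]) (auto simp: vanishes_def spread_identify)
  then show ?thesis using n by (auto simp: vanishes_def poly_below_0)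
qed

text \<open>
  With one hyperplane fewer than in \<open>vanishes_by_degree\<close> the restriction is a constant multiple of the product
  of differences, and a single further subspace on which it vanishes, but that product does not, shows that
  the constant is zero.
\<close>

lemma vanishes_by_value:
  fixes f :: "(nat \<Rightarrow> 'k::field_char_0) \<Rightarrow> 'k"
  assumes f: "poly_below (Suc n) f"
    and S: "distinct S" "\<forall>(i, j)\<in>set S. i < j \<and> vanishes f (identify i j \<sigma>)"
    and n: "n \<le> length S"
    and \<rho>: "vanishes f (map \<rho> \<sigma>)" "\<forall>(i, j)\<in>set S. \<rho> i \<noteq> \<rho> j"
  shows "vanishes f \<sigma>"
proof -
  have "\<exists>g. poly_below (Suc n - length S) g \<and> (\<forall>z. f (spread \<sigma> z) = pair_product S z * g z)"
    using S by (intro factor_pairs[OF poly_below_spread[OF f]]) (auto simp: vanishes_def spread_identify)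
  then obtain g where "poly_below (Suc n - length S) g"
    and fg: "\<forall>z. f (spread \<sigma> z) = pair_product S z * g z" by blast
  then have g: "poly_below 1 g" using n by (auto elim: poly_below_mono)
  have c: "poly_below m g \<Longrightarrow> m \<le> 1 \<Longrightarrow> \<exists>c. \<forall>z. g z = c" for m g
  proof (induction rule: poly_below.induct)
    case (var n f i)
    then show ?case using poly_below_0[of f] by auto
  qed auto
  obtain c where c: "\<And>z. g z = c" using c[OF g(1)] by auto
  define S' where "S' = map (\<lambda>(i, j). (\<rho> i, \<rho> j)) S"
  have S': "pair_product S' z = pair_product S (\<lambda>l. z (\<rho> l))" for z
    unfolding S'_def by (induction S) auto
  have "pair_product S' z * c = 0" for z
    using \<rho>(1) fg c unfolding vanishes_def spread_map S' by auto
  moreover have "poly_below 1 (\<lambda>z. c)" using poly_below.const[of 0] by simp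
  moreover have "\<forall>(i, j)\<in>set S'. i \<noteq> j" using \<rho>(2) by (auto simp: S'_def)
  ultimately have "c = 0" using pair_product_cancel[of 1 "\<lambda>z. c" S'] by blast
  then show ?thesis using fg c by (simp add: vanishes_def)
qed

definition adjacent :: "nat \<Rightarrow> (nat \<times> nat) list" where
  "adjacent m = map (\<lambda>i. (i, Suc i)) [0..<m]"

text \<open>
  On a pattern without equal neighbours the product of the differences of neighbours is not identically zero, so there
  the zeros of \<open>f\<close> are inherited by the quotient \<open>r\<close>. The degree of \<open>r\<close> is so small that few zeros suffice.
\<close>

lemma adjacent_factor:
  fixes f :: "(nat \<Rightarrow> 'k::field_char_0) \<Rightarrow> 'k"
  assumes f: "poly_below n f"
    and adj: "\<forall>i<m. vanishes f (identify i (Suc i) [0..<Suc m])"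
  shows "\<exists>r :: (nat \<Rightarrow> 'k) \<Rightarrow> 'k. poly_below (n - m) r
    \<and> (\<forall>\<sigma>. vanishes f \<sigma> \<longrightarrow> length \<sigma> = Suc m \<longrightarrow> distinct_adj \<sigma> \<longrightarrow> vanishes r \<sigma>)
    \<and> (vanishes r [0..<Suc m] \<longrightarrow> vanishes f [0..<Suc m])"
proof -
  let ?id = "[0..<Suc m]"
  have "\<exists>g :: (nat \<Rightarrow> 'k) \<Rightarrow> 'k. poly_below (n - length (adjacent m)) g
      \<and> (\<forall>z. f (spread ?id z) = pair_product (adjacent m) z * g z)"
    using adj by (intro factor_pairs[OF poly_below_spread[OF f]])
      (auto simp: vanishes_def spread_identify adjacent_def distinct_map inj_on_def)
  then obtain g where g: "poly_below (n - m) g" "\<And>z. f (spread ?id z) = pair_product (adjacent m) z * g z"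
    by (auto simp: adjacent_def)
  have idem: "spread ?id (spread \<sigma> w) = spread \<sigma> w" if "length \<sigma> = Suc m" for \<sigma> and w :: "nat \<Rightarrow> 'k"
    using that by (auto simp: spread_def fun_eq_iff simp del: upt_Suc)
  show ?thesis
  proof (intro exI[of _ g] conjI allI impI)
    show "poly_below (n - m) g" by (rule g(1))
    fix \<sigma>
    assume \<sigma>: "vanishes f \<sigma>" "length \<sigma> = Suc m" "distinct_adj \<sigma>"
    show "vanishes g \<sigma>"
    proof -
      define S where "S = map (\<lambda>(i, j). (\<sigma> ! i, \<sigma> ! j)) (adjacent m)"
      have "pair_product S w = pair_product (adjacent m) (spread \<sigma> w)" for w :: "nat \<Rightarrow> 'k"
      proof -
        have "map (\<lambda>(i, j). w (\<sigma> ! i) - w (\<sigma> ! j)) (adjacent m)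
            = map (\<lambda>(i, j). spread \<sigma> w i - spread \<sigma> w j) (adjacent m)"
          using \<sigma>(2) by (auto simp: adjacent_def spread_def)
        from arg_cong[OF this, of prod_list] show ?thesis
          by (simp add: S_def pair_product_def comp_def case_prod_unfold del: map_eq_conv)
      qed
      then have "pair_product S w * g (spread \<sigma> w) = 0" for w
        using \<sigma>(1) g(2)[of "spread \<sigma> w"] idem[OF \<sigma>(2)] by (simp add: vanishes_def)
      moreover have "\<forall>(i, j)\<in>set S. i \<noteq> j"
        using \<sigma>(2,3) by (auto simp: S_def adjacent_def distinct_adj_conv_nth)
      ultimately show ?thesis
        unfolding vanishes_def using pair_product_cancel[OF poly_below_spread[OF g(1)]] by blast
    qed
  next
    assume "vanishes g ?id"
    show "vanishes f ?id"
    proof -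
      have "f (spread ?id w) = 0" for w
        using g(2)[of "spread ?id w"] idem[of ?id w] \<open>vanishes g ?id\<close> by (simp add: vanishes_def del: upt_Suc)
      then show ?thesis by (simp add: vanishes_def)
    qed
  qed
qed

section \<open>Trails with prescribed edges\<close>

definition edges :: "'a list \<Rightarrow> ('a \<times> 'a) list" where
  "edges \<sigma> = zip \<sigma> (tl \<sigma>)"

lemma edges_simps [simp]: "edges [] = []" "edges [a] = []" "edges (a # b # \<sigma>) = (a, b) # edges (b # \<sigma>)"
  by (simp_all add: edges_def)

lemma edges_Cons: "\<sigma> \<noteq> [] \<Longrightarrow> edges (a # \<sigma>) = (a, hd \<sigma>) # edges \<sigma>"
  by (cases \<sigma>) simp_all

lemma length_edges [simp]: "length (edges \<sigma>) = length \<sigma> - 1"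
  by (simp add: edges_def)

primrec walks :: "nat \<Rightarrow> 'a \<Rightarrow> ('a \<times> 'a) list \<Rightarrow> 'a list list" where
  "walks 0 a E = [[a]]"
| "walks (Suc n) a E = concat (map
     (\<lambda>e. if fst e = a then map ((#) a) (walks n (snd e) (remove1 e E)) else []) (remdups E))"

text \<open>
  Only this inclusion matters: listing too many candidates in a trail relation is harmless as long as they are all
  shown to vanish.
\<close>

lemma walks_complete:
  "length \<tau> = Suc n \<Longrightarrow> mset (edges \<tau>) = mset E \<Longrightarrow> \<tau> \<in> set (walks n (hd \<tau>) E)"
proof (induction n arbitrary: \<tau> E)
  case 0
  then show ?case by (auto simp: length_Suc_conv)
next
  case (Suc n)
  then obtain a b \<tau>' where \<tau>: "\<tau> = a # b # \<tau>'"
    by (auto simp: length_Suc_conv)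
  have e: "(a, b) \<in> set E" using Suc.prems(2) \<tau> by (metis edges_simps(3) list.set_intros(1) mset_eq_setD)
  have "mset (edges (b # \<tau>')) = mset (remove1 (a, b) E)"
    using Suc.prems(2) \<tau> by (metis add_mset_remove_trivial edges_simps(3) mset.simps(2) mset_remove1)
  then have "b # \<tau>' \<in> set (walks n b (remove1 (a, b) E))"
    using Suc.IH[of "b # \<tau>'"] Suc.prems(1) \<tau> by simp
  then show ?case using e \<tau> by force
qed

text \<open>
  The Eulerian trails of the multigraph traversed by \<open>\<sigma>\<close>, with the same ends as \<open>\<sigma>\<close>.
\<close>

definition retracings :: "'a list \<Rightarrow> 'a list set" where
  "retracings \<sigma> = {\<tau>. length \<tau> = length \<sigma> \<and> hd \<tau> = hd \<sigma> \<and> last \<tau> = last \<sigma> \<and>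
     mset (edges \<tau>) = mset (edges \<sigma>)}"

definition trails :: "nat list \<Rightarrow> nat list list" where
  "trails \<sigma> = walks (length \<sigma> - 1) (hd \<sigma>) (edges \<sigma>)"

lemma retracings_subset: "\<sigma> \<noteq> [] \<Longrightarrow> retracings \<sigma> \<subseteq> set (trails \<sigma>)"
proof
  fix \<tau>
  assume "\<sigma> \<noteq> []" "\<tau> \<in> retracings \<sigma>"
  then show "\<tau> \<in> set (trails \<sigma>)"
    using walks_complete[of \<tau> "length \<sigma> - 1" "edges \<sigma>"] by (auto simp: retracings_def trails_def)
qed

text \<open>
  The relations that off-diagonal entries impose on the part of degree \<open>b\<close> in \<open>y\<close>. Labels are natural numbers
  to make patterns computable; at most four of them occur in a walk because the matrices have four rows.
\<close>

definition balanced :: "nat \<Rightarrow> ((nat \<Rightarrow> 'k::comm_ring_1) \<Rightarrow> 'k) \<Rightarrow> bool" where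
  "balanced b p \<longleftrightarrow> (\<forall>\<sigma> w. length \<sigma> = Suc b \<longrightarrow> hd \<sigma> \<noteq> last \<sigma> \<longrightarrow> card (set \<sigma>) \<le> 4 \<longrightarrow>
     (\<Sum>\<tau>\<in>retracings \<sigma>. p (spread \<tau> w)) = 0)"

definition open_four :: "nat list \<Rightarrow> bool" where
  "open_four \<sigma> \<longleftrightarrow> hd \<sigma> \<noteq> last \<sigma> \<and> length (remdups \<sigma>) \<le> 4"

text \<open>
  The map \<open>\<rho>\<close> merges further labels. A relation between trails may thus be used on a smaller subspace,
  where more of its terms are already known to vanish; there the ends are even allowed to coincide.
\<close>

lemma trail_relation:
  assumes "balanced b p" "length \<sigma> = Suc b" "open_four \<sigma>"
    and others: "list_all (\<lambda>\<tau>. \<tau> = \<sigma> \<or> vanishes p (map \<rho> \<tau>)) (trails \<sigma>)"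
  shows "vanishes p (map \<rho> \<sigma>)"
  unfolding vanishes_def
proof
  fix w :: "nat \<Rightarrow> 'a"
  let ?w = "\<lambda>l. w (\<rho> l)"
  have ne: "\<sigma> \<noteq> []" using assms(2) by auto
  have fin: "finite (retracings \<sigma>)"
    using retracings_subset[OF ne] finite_subset by blast
  have "(\<Sum>\<tau>\<in>retracings \<sigma>. p (spread \<tau> ?w)) = 0"
    using assms(1-3) unfolding balanced_def open_four_def by (simp add: length_remdups_card_conv)
  moreover have "(\<Sum>\<tau>\<in>retracings \<sigma>. p (spread \<tau> ?w)) = p (spread \<sigma> ?w)"
  proof -
    have "p (spread \<tau> ?w) = 0" if "\<tau> \<in> retracings \<sigma> - {\<sigma>}" for \<tau>
      using that others retracings_subset[OF ne]
      by (auto simp: list_all_iff vanishes_def spread_map)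
    moreover have "\<sigma> \<in> retracings \<sigma>" by (simp add: retracings_def)
    ultimately show ?thesis using fin by (simp add: sum.remove[of _ \<sigma>])
  qed
  ultimately show "p (spread (map \<rho> \<sigma>) w) = 0" by (simp add: spread_map)
qed

lemma trail_relation_id:
  assumes "balanced b p" "length \<sigma> = Suc b" "open_four \<sigma>"
    and "list_all (\<lambda>\<tau>. \<tau> = \<sigma> \<or> vanishes p \<tau>) (trails \<sigma>)"
  shows "vanishes p \<sigma>"
  using trail_relation[OF assms(1-3), of id] assms(4) by (simp add: list.map_id0)

lemma edges_map: "edges (map f \<tau>) = map (map_prod f f) (edges \<tau>)"
  by (simp add: edges_def zip_map_map map_prod_def case_prod_unfold flip: map_tl)

lemma set_edges:
  "2 \<le> length \<tau> \<Longrightarrow> set \<tau> = fst ` set (edges \<tau>) \<union> snd ` set (edges \<tau>)"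
proof (induction \<tau>)
  case (Cons a \<tau>)
  show ?case
  proof (cases "2 \<le> length \<tau>")
    case True
    then obtain b \<tau>' where "\<tau> = b # \<tau>'" by (cases \<tau>) auto
    then show ?thesis using Cons.IH[OF True] by auto
  next
    case False
    then obtain b where "\<tau> = [b]" using Cons.prems by (cases \<tau>) (auto simp: Suc_le_eq)
    then show ?thesis by auto
  qed
qed simp

lemma set_retracing:
  assumes "\<tau> \<in> retracings \<sigma>" "2 \<le> length \<sigma>"
  shows "set \<tau> = set \<sigma>"
proof -
  have "set (edges \<tau>) = set (edges \<sigma>)" "length \<tau> = length \<sigma>"
    using assms(1) by (auto simp: retracings_def dest: mset_eq_setD)
  then show ?thesis using set_edges[of \<tau>] set_edges[of \<sigma>] assms(2) by simp
qed

lemma map_retracing: 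
  assumes "\<tau> \<in> retracings \<sigma>" "\<sigma> \<noteq> []"
  shows "map f \<tau> \<in> retracings (map f \<sigma>)"
proof -
  have "\<tau> \<noteq> []" using assms by (auto simp: retracings_def)
  then show ?thesis using assms by (simp add: retracings_def edges_map hd_map last_map)
qed

text \<open>
  Trails depend only on the shape of the multigraph. A trail with an edge visits only end points of its edges,
  so a relabelling injective on \<open>\<sigma>\<close> is injective on all vertices involved.
\<close>

lemma bij_betw_retracings:
  assumes e: "inj_on e (set \<sigma>)" and \<sigma>: "2 \<le> length \<sigma>"
  shows "bij_betw (map e) (retracings \<sigma>) (retracings (map e \<sigma>))"
proof (rule bij_betw_byWitness)
  let ?d = "inv_into (set \<sigma>) e"
  have ne: "\<sigma> \<noteq> []" using \<sigma> by auto
  have de: "map ?d (map e \<tau>) = \<tau>" if "set \<tau> = set \<sigma>" for \<tau>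
    using that e by (simp add: map_idI flip: that)
  show "\<forall>\<tau>\<in>retracings \<sigma>. map ?d (map e \<tau>) = \<tau>" using set_retracing[OF _ \<sigma>] de by blast
  show "\<forall>\<tau>\<in>retracings (map e \<sigma>). map e (map ?d \<tau>) = \<tau>"
  proof
    fix \<tau>
    assume "\<tau> \<in> retracings (map e \<sigma>)"
    then have "set \<tau> = e ` set \<sigma>" using set_retracing[of \<tau> "map e \<sigma>"] \<sigma> by simp
    then show "map e (map ?d \<tau>) = \<tau>" by (auto simp: f_inv_into_f intro!: map_idI)
  qed
  show "map e ` retracings \<sigma> \<subseteq> retracings (map e \<sigma>)" using map_retracing ne by blast
  show "map ?d ` retracings (map e \<sigma>) \<subseteq> retracings \<sigma>"
    using map_retracing[of _ "map e \<sigma>" ?d] ne de[of \<sigma>] by auto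
qed

section \<open>Counting linear factors\<close>

text \<open>
  An executable sufficient condition for vanishing on \<open>\<sigma>\<close> given vanishing on the patterns in \<open>K\<close>: either
  \<open>\<sigma>\<close> describes a smaller subspace, or it is a trail all of whose rivals do.
\<close>

definition derivable :: "nat list list \<Rightarrow> nat list \<Rightarrow> bool" where
  "derivable K \<sigma> \<longleftrightarrow> list_ex (coarser \<sigma>) K \<or>
     open_four \<sigma> \<and> list_all (\<lambda>\<tau>. \<tau> = \<sigma> \<or> list_ex (coarser \<tau>) K) (trails \<sigma>)"

lemma derivable_vanishes:
  assumes "balanced b p" "\<forall>\<kappa>\<in>set K. vanishes p \<kappa>" "length \<sigma> = Suc b" "derivable K \<sigma>"
  shows "vanishes p \<sigma>"
proof -
  have K: "vanishes p \<tau>" if "list_ex (coarser \<tau>) K" for \<tau>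
    using that assms(2) vanishes_coarser by (auto simp: list_ex_iff)
  show ?thesis
  proof (cases "list_ex (coarser \<sigma>) K")
    case True
    then show ?thesis by (rule K)
  next
    case False
    then have "open_four \<sigma>" "list_all (\<lambda>\<tau>. \<tau> = \<sigma> \<or> vanishes p \<tau>) (trails \<sigma>)"
      using assms(4) K by (auto simp: derivable_def list_all_iff)
    then show ?thesis using assms(1,3) by (rule_tac trail_relation_id)
  qed
qed

definition pairs :: "nat \<Rightarrow> (nat \<times> nat) list" where
  "pairs m = concat (map (\<lambda>j. map (\<lambda>i. (i, j)) [0..<j]) [0..<m])"

lemma distinct_pairs: "distinct (pairs m)"
  unfolding pairs_def
  by (induction m) (auto simp: distinct_map inj_on_def)

lemma pairs_less: "(i, j) \<in> set (pairs m) \<Longrightarrow> i < j"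
  by (auto simp: pairs_def)

definition zero_pairs :: "(nat list \<Rightarrow> bool) \<Rightarrow> nat \<Rightarrow> nat list \<Rightarrow> (nat \<times> nat) list" where
  "zero_pairs F m \<sigma> = filter (\<lambda>(i, j). F (identify i j \<sigma>)) (pairs m)"

lemma vanishes_by_count:
  fixes f :: "(nat \<Rightarrow> 'k::field_char_0) \<Rightarrow> 'k"
  assumes "poly_below n f" "\<And>\<tau>. length \<tau> = length \<sigma> \<Longrightarrow> F \<tau> \<Longrightarrow> vanishes f \<tau>"
    and "n \<le> length (zero_pairs F m \<sigma>)"
  shows "vanishes f \<sigma>"
  using assms(1) _ _ assms(3)
proof (rule vanishes_by_degree)
  show "distinct (zero_pairs F m \<sigma>)" by (simp add: zero_pairs_def distinct_pairs)
  show "\<forall>(i, j)\<in>set (zero_pairs F m \<sigma>). i < j \<and> vanishes f (identify i j \<sigma>)"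
    using assms(2) pairs_less by (auto simp: zero_pairs_def identify_def)
qed

lemma vanishes_by_count_and_value:
  fixes f :: "(nat \<Rightarrow> 'k::field_char_0) \<Rightarrow> 'k"
  assumes f: "poly_below (Suc n) f" and F: "\<And>\<tau>. length \<tau> = length \<sigma> \<Longrightarrow> F \<tau> \<Longrightarrow> vanishes f \<tau>"
    and n: "n \<le> length (zero_pairs F m \<sigma>)"
    and \<rho>: "vanishes f (map \<rho> \<sigma>)" "list_all (\<lambda>(i, j). \<rho> i \<noteq> \<rho> j) (zero_pairs F m \<sigma>)"
  shows "vanishes f \<sigma>"
proof (rule vanishes_by_value[OF f _ _ n \<rho>(1)])
  show "distinct (zero_pairs F m \<sigma>)" by (simp add: zero_pairs_def distinct_pairs)
  show "\<forall>(i, j)\<in>set (zero_pairs F m \<sigma>). i < j \<and> vanishes f (identify i j \<sigma>)"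
    using F pairs_less by (auto simp: zero_pairs_def identify_def)
  show "\<forall>(i, j)\<in>set (zero_pairs F m \<sigma>). \<rho> i \<noteq> \<rho> j"
    using \<rho>(2) by (auto simp: list_all_iff)
qed

lemma vanishes_stage:
  fixes p :: "(nat \<Rightarrow> 'k::field_char_0) \<Rightarrow> 'k"
  assumes "balanced b p" "poly_below n p" "\<forall>\<kappa>\<in>set K. vanishes p \<kappa>"
    and "list_all (\<lambda>\<sigma>. length \<sigma> = Suc b \<and> n \<le> length (zero_pairs (derivable K) m \<sigma>)) L"
  shows "\<forall>\<kappa>\<in>set L. vanishes p \<kappa>"
proof
  fix \<sigma>
  assume "\<sigma> \<in> set L"
  then have len: "length \<sigma> = Suc b" and n: "n \<le> length (zero_pairs (derivable K) m \<sigma>)"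
    using assms(4) by (auto simp: list_all_iff)
  show "vanishes p \<sigma>"
  proof (rule vanishes_by_count[OF assms(2) _ n])
    show "vanishes p \<tau>" if "length \<tau> = length \<sigma>" "derivable K \<tau>" for \<tau>
      using that len by (intro derivable_vanishes[OF assms(1,3)]) simp_all
  qed
qed

text \<open>
  Divide \<open>f\<close> by the product of the \<open>m\<close> differences of neighbours. The quotient has degree at most \<open>n\<close>, and
  it inherits the zeros recorded by \<open>G\<close>. Each pair in \<open>S\<close> gives a hyperplane on which the quotient is zero by a degree count,
  so the quotient is a constant times \<open>n\<close> differences; the pattern \<open>\<rho>\<close> rules out a nonzero constant.
\<close>

lemma vanishes_via_adjacent:
  fixes f :: "(nat \<Rightarrow> 'k::field_char_0) \<Rightarrow> 'k"
  assumes f: "poly_below (Suc n + m) f"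
    and F: "\<And>\<tau>. length \<tau> = Suc m \<Longrightarrow> F \<tau> \<Longrightarrow> vanishes f \<tau>"
    and adj: "list_all (\<lambda>i. F (identify i (Suc i) [0..<Suc m])) [0..<m]"
    and G: "G = (\<lambda>\<tau>. distinct_adj \<tau> \<and> F \<tau>)"
    and S: "distinct S" "n \<le> length S"
      "list_all (\<lambda>(i, j). i < j \<and> Suc n \<le> length (zero_pairs G (Suc m) (identify i j [0..<Suc m]))) S"
    and \<rho>: "G (map \<rho> [0..<Suc m])" "list_all (\<lambda>(i, j). \<rho> i \<noteq> \<rho> j) S"
  shows "vanishes f [0..<Suc m]"
proof -
  have "\<forall>i<m. vanishes f (identify i (Suc i) [0..<Suc m])"
    using adj by (auto simp: list_all_iff identify_def intro!: F)
  from adjacent_factor[OF f this] obtain r :: "(nat \<Rightarrow> 'k) \<Rightarrow> 'k" where r: "poly_below (Suc n) r"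
    and rG: "\<And>\<sigma>. vanishes f \<sigma> \<Longrightarrow> length \<sigma> = Suc m \<Longrightarrow> distinct_adj \<sigma> \<Longrightarrow> vanishes r \<sigma>"
    and rf: "vanishes r [0..<Suc m] \<Longrightarrow> vanishes f [0..<Suc m]"
    by auto
  have rG: "vanishes r \<tau>" if "length \<tau> = Suc m" "G \<tau>" for \<tau>
    using that rG F by (auto simp: G)
  have "vanishes r [0..<Suc m]"
  proof (rule vanishes_by_value[OF r S(1) _ S(2)])
    show "\<forall>(i, j)\<in>set S. i < j \<and> vanishes r (identify i j [0..<Suc m])"
    proof clarify
      fix i j
      assume "(i, j) \<in> set S"
      then have ij: "i < j" "Suc n \<le> length (zero_pairs G (Suc m) (identify i j [0..<Suc m]))"
        using S(3) by (auto simp: list_all_iff)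
      have "vanishes r (identify i j [0..<Suc m])"
        by (rule vanishes_by_count[OF r _ ij(2)]) (rule rG, auto simp: identify_def)
      with ij(1) show "i < j \<and> vanishes r (identify i j [0..<Suc m])" ..
    qed
    show "vanishes r (map \<rho> [0..<Suc m])" by (rule rG[OF _ \<rho>(1)]) simp
    show "\<forall>(i, j)\<in>set S. \<rho> i \<noteq> \<rho> j" using \<rho>(2) by (auto simp: list_all_iff)
  qed
  then show ?thesis by (rule rf)
qed

text \<open>
  Stuttering at position \<open>k\<close> adds a loop at that vertex of the walk.
\<close>

definition stutter :: "nat \<Rightarrow> nat list \<Rightarrow> nat list" where
  "stutter k \<sigma> = take (Suc k) \<sigma> @ drop k \<sigma>"

section \<open>Trail relations in low degree force the zero polynomial\<close>

text \<open>
  Identifying two neighbours leaves five variables and seven forced hyperplanes in degree seven, so each such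
  restriction is a multiple of a product of seven differences. For a loop at the middle vertex the
  multiple is zero because of one two-term relation; with this restriction gone, further two-term relations give the others
  an eighth factor. The product of the five differences of neighbours then divides \<open>p\<close>, leaving a quadratic quotient.
\<close>

lemma balanced_5:
  fixes p :: "(nat \<Rightarrow> 'k::field_char_0) \<Rightarrow> 'k"
  assumes p: "balanced 5 p" "poly_below 8 p"
  shows "vanishes p [0..<6]"
proof -
  \<comment> \<open>The loop at the vertex visited twice may be used at either visit. Once the last vertex is merged with
    it, the other choice has a zero, as a coarsening of a walk with a single trail.\<close>
  have "vanishes p (map (\<lambda>l. if l = 4 then 0 else l) [0,1,0,0,3,4])"
  proof (rule trail_relation[OF p(1)])
    have "vanishes p [0,0,1,2,3,2]"
      by (rule derivable_vanishes[OF p(1), of "[]"]) (simp_all, code_simp)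
    then have "vanishes p [0,0,1,0,3,0]"
      by (rule vanishes_coarser) code_simp
    then show "list_all (\<lambda>\<tau>. \<tau> = [0,1,0,0,3,4] \<or> vanishes p (map (\<lambda>l. if l = 4 then 0 else l) \<tau>))
       (trails [0,1,0,0,3,4])" by (simp add: trails_def)
    show "open_four [0,1,0,0,3,4]" by code_simp
  qed simp
  then have v: "vanishes p (map (\<lambda>l. if l = 2 \<or> l = 4 then 0 else l) [0,1,2,2,3,4])" by simp
  have Q2: "vanishes p [0,1,2,2,3,4]"
  proof (rule vanishes_by_count_and_value[where F = "derivable []" and n = 7 and m = 5, OF _ _ _ v])
    show "poly_below (Suc 7) p" using p(2) by simp
    show "vanishes p \<tau>" if "length \<tau> = length [0::nat,1,2,2,3,4]" "derivable [] \<tau>" for \<tau>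
      by (rule derivable_vanishes[OF p(1) _ _ that(2)]) (use that(1) in simp_all)
  qed code_simp+
  let ?Q = "\<lambda>k. stutter k [0,1,2,3,4]"
  have K: "\<forall>\<kappa>\<in>set [?Q 2]. vanishes p \<kappa>" using Q2 by (simp add: stutter_def)
  have "\<forall>\<kappa>\<in>set [?Q 0, ?Q 4]. vanishes p \<kappa>"
    by (rule vanishes_stage[OF p K, where m = 5]) code_simp
  with K have K: "\<forall>\<kappa>\<in>set [?Q 0, ?Q 2, ?Q 4]. vanishes p \<kappa>" by simp
  have "\<forall>\<kappa>\<in>set [?Q 1, ?Q 3]. vanishes p \<kappa>"
    by (rule vanishes_stage[OF p K, where m = 5]) code_simp
  with K have K: "\<forall>\<kappa>\<in>set [?Q 0, ?Q 1, ?Q 2, ?Q 3, ?Q 4]. vanishes p \<kappa>" by simp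
  let ?F = "derivable [?Q 0, ?Q 1, ?Q 2, ?Q 3, ?Q 4]"
  have "vanishes p [0..<Suc 5]"
  proof (rule vanishes_via_adjacent[where F = ?F and \<rho> = "(!) [0,1,0,3,4,3]" and S = "[(1,3),(2,4)]", OF _ _ _ refl])
    show "poly_below (Suc 2 + 5) p" using p(2) by simp
    show "vanishes p \<tau>" if "length \<tau> = Suc 5" "?F \<tau>" for \<tau>
      using derivable_vanishes[OF p(1) K] that by simp
  qed code_simp+
  then show ?thesis by simp
qed

lemma vanishes_stutter:
  assumes "length \<sigma> = m" "k < m"
  shows "vanishes (\<lambda>z. p (spread (stutter k [0..<m]) z)) \<sigma> \<longleftrightarrow> vanishes p (stutter k \<sigma>)"
proof -
  have "spread (stutter k [0..<m]) (spread \<sigma> w) = spread (stutter k \<sigma>) w" for w :: "nat \<Rightarrow> 'a"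
    using assms by (auto simp: spread_def stutter_def fun_eq_iff nth_append less_Suc_eq)
  then show ?thesis by (simp add: vanishes_def)
qed

text \<open>
  Two loops at the vertices \<open>k\<close> and \<open>l\<close> of a walk through five vertices leave five variables in degree six. For \<open>k = l\<close> seven hyperplanes
  are forced (\<open>?T\<close>). For vertices that are not neighbours, and not both ends, the relation that distributes two
  loops over two visits of one vertex supplies a seventh (\<open>?U\<close>). The remaining cases \<open>?V\<close> follow by relations
  that pair them with \<open>?U\<close>. A single loop at \<open>k\<close> thus gives a polynomial in six variables divisible by the five differences of neighbours,
  with a linear quotient that is killed by \<open>vanishes_via_adjacent\<close>. Finally \<open>p\<close> is a constant times
  the six differences of neighbours, and one trail suffices.
\<close>

lemma balanced_6:
  fixes p :: "(nat \<Rightarrow> 'k::field_char_0) \<Rightarrow> 'k"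
  assumes p: "balanced 6 p" "poly_below 7 p"
  shows "vanishes p [0..<7]"
proof -
  let ?D = "\<lambda>k l. stutter k (stutter l [0,1,2,3,4])"
  let ?T = "[?D 0 0, ?D 1 1, ?D 2 2, ?D 3 3, ?D 4 4]"
  let ?U = "[?D 0 2, ?D 0 3, ?D 1 3, ?D 1 4, ?D 2 4]"
  let ?V = "[?D 0 1, ?D 1 2, ?D 2 3, ?D 3 4, ?D 0 4]"
  have K: "\<forall>\<kappa>\<in>set []. vanishes p \<kappa>" by simp
  have T: "\<forall>\<kappa>\<in>set ?T. vanishes p \<kappa>"
    by (rule vanishes_stage[OF p K, where m = 5]) code_simp
  have U: "\<forall>\<kappa>\<in>set ?U. vanishes p \<kappa>"
    by (rule vanishes_stage[OF p T, where m = 5]) code_simp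
  have TU: "\<forall>\<kappa>\<in>set (?T @ ?U). vanishes p \<kappa>"
    using T U by (simp only: set_append ball_Un)
  have V: "\<forall>\<kappa>\<in>set ?V. vanishes p \<kappa>"
    by (rule vanishes_stage[OF p TU, where m = 5]) code_simp
  have TUV: "\<forall>\<kappa>\<in>set (?T @ ?U @ ?V). vanishes p \<kappa>"
    using T U V by (simp only: set_append ball_Un)
  let ?Q = "\<lambda>k. stutter k [0..<6]"
  have Q: "vanishes p (?Q k)"
    if K: "\<forall>\<kappa>\<in>set K. vanishes p \<kappa>" and k: "k < 6"
      and adj: "list_all (\<lambda>i. derivable K (stutter k (identify i (Suc i) [0..<Suc 5]))) [0..<5]"
      and ij: "list_all (\<lambda>(i, j). i < j \<and> Suc 1 \<le> length (zero_pairs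
          (\<lambda>\<tau>. distinct_adj \<tau> \<and> derivable K (stutter k \<tau>)) (Suc 5) (identify i j [0..<Suc 5]))) [ij]"
      and \<rho>: "(\<lambda>\<tau>. distinct_adj \<tau> \<and> derivable K (stutter k \<tau>)) (map ((!) \<rho>) [0..<Suc 5])"
        "list_all (\<lambda>(i, j). \<rho> ! i \<noteq> \<rho> ! j) [ij]"
    for K k ij \<rho>
  proof -
    let ?q = "\<lambda>z. p (spread (stutter k [0..<6]) z)"
    have "vanishes ?q [0..<Suc 5]"
    proof (rule vanishes_via_adjacent[where F = "\<lambda>\<tau>. derivable K (stutter k \<tau>)" and S = "[ij]",
          OF _ _ adj refl _ _ ij \<rho>])
      show "poly_below (Suc 1 + 5) ?q" using p(2) by (simp add: poly_below_spread)
      fix \<tau> :: "nat list"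
      assume len: "length \<tau> = Suc 5" and "derivable K (stutter k \<tau>)"
      then have "vanishes p (stutter k \<tau>)"
        using k by (intro derivable_vanishes[OF p(1) K]) (simp_all add: stutter_def)
      then show "vanishes ?q \<tau>" using len k by (simp add: vanishes_stutter)
    qed simp_all
    then show ?thesis using k by (simp add: vanishes_stutter)
  qed
  have Q0: "vanishes p (?Q 0)"
    by (rule Q[OF TUV, where ij = "(2, 4)" and \<rho> = "[0,4,5,3,4,5]"]) code_simp+
  have Q2: "vanishes p (?Q 2)"
    by (rule Q[OF TUV, where ij = "(0, 4)" and \<rho> = "[3,4,2,3,4,5]"]) code_simp+
  have Q3: "vanishes p (?Q 3)"
    by (rule Q[OF TUV, where ij = "(1, 5)" and \<rho> = "[0,4,5,3,4,5]"]) code_simp+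
  have Q5: "vanishes p (?Q 5)"
    by (rule Q[OF TUV, where ij = "(1, 3)" and \<rho> = "[3,4,2,3,4,5]"]) code_simp+
  \<comment> \<open>A loop at the second or the fifth vertex has too few walks with a single trail; the relations
    shifting the loop to another visit of its vertex need the cases already settled.\<close>
  have K: "\<forall>\<kappa>\<in>set ([?Q 2, ?Q 3] @ ?T @ ?U @ ?V). vanishes p \<kappa>"
    using TUV Q2 Q3 by (simp only: set_append ball_Un) simp
  have Q1: "vanishes p (?Q 1)"
    by (rule Q[OF K, where ij = "(3, 5)" and \<rho> = "[2,1,2,1,4,5]"]) code_simp+
  have Q4: "vanishes p (?Q 4)"
    by (rule Q[OF K, where ij = "(0, 2)" and \<rho> = "[0,1,4,3,4,3]"]) code_simp+
  have K: "\<forall>\<kappa>\<in>set [?Q 0, ?Q 1, ?Q 2, ?Q 3, ?Q 4, ?Q 5]. vanishes p \<kappa>"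
    using Q0 Q1 Q2 Q3 Q4 Q5 by simp
  let ?F = "derivable [?Q 0, ?Q 1, ?Q 2, ?Q 3, ?Q 4, ?Q 5]"
  have "vanishes p [0..<Suc 6]"
  proof (rule vanishes_via_adjacent[where F = ?F and n = 0 and \<rho> = "(!) [0,1,0,1,2,3,2]" and S = "[]",
        OF _ _ _ refl])
    show "poly_below (Suc 0 + 6) p" using p(2) by simp
    show "vanishes p \<tau>" if "length \<tau> = Suc 6" "?F \<tau>" for \<tau>
      using derivable_vanishes[OF p(1) K] that by simp
  qed code_simp+
  then show ?thesis by simp
qed

text \<open>
  Of the ten pairs among five positions, all but the two ends yield a walk that is the only trail with its
  edges. This gives nine factors in degree eight.
\<close>

lemma balanced_4:
  fixes p :: "(nat \<Rightarrow> 'k::field_char_0) \<Rightarrow> 'k"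
  assumes p: "balanced 4 p" "poly_below 9 p"
  shows "vanishes p [0..<5]"
proof -
  have K: "\<forall>\<kappa>\<in>set []. vanishes p \<kappa>" by simp
  have "\<forall>\<kappa>\<in>set [[0..<5]]. vanishes p \<kappa>"
    by (rule vanishes_stage[OF p K, where m = 5]) code_simp
  then show ?thesis by simp
qed

text \<open>
  A walk through distinct vertices is the only trail with its edges.
\<close>

lemma balanced_1_2_3:
  fixes p :: "(nat \<Rightarrow> 'k::field_char_0) \<Rightarrow> 'k"
  assumes p: "balanced b p" "b \<in> {1, 2, 3}"
  shows "vanishes p [0..<Suc b]"
proof (rule derivable_vanishes[OF p(1)])
  have "\<forall>b\<in>set [1,2,3]. derivable [] [0..<Suc b]" by code_simp
  then show "derivable [] [0..<Suc b]" using p(2) by auto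
qed simp_all

lemma balanced_imp_vanishes:
  fixes p :: "(nat \<Rightarrow> 'k::field_char_0) \<Rightarrow> 'k"
  assumes "balanced b p" "poly_below (13 - b) p" "1 \<le> b" "b \<le> 6"
  shows "vanishes p [0..<Suc b]"
proof -
  have "b \<in> {1, 2, 3} \<or> b = 4 \<or> b = 5 \<or> b = 6" using assms(3,4) by auto
  then show ?thesis
    using assms(1,2) balanced_1_2_3 balanced_4[of p] balanced_5[of p] balanced_6[of p] by (auto simp: eval_nat_numeral)
qed

section \<open>Linear independence of monomials\<close>

lemma prod_mset_fun_upd:
  fixes s :: "'a \<Rightarrow> 'k::comm_monoid_mult"
  shows "prod_mset (image_mset (s(e := t)) m)
    = t ^ count m e * prod_mset (image_mset s (filter_mset (\<lambda>a. a \<noteq> e) m))"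
  by (induction m) (auto simp: ac_simps)

text \<open>
  Induction on the set of variables: a polynomial that is zero as a function of one variable \<open>e\<close> over an infinite field
  has zero coefficients, and these are combinations of monomials in the other variables.
\<close>

lemma monomials_independent:
  fixes c :: "'a multiset \<Rightarrow> 'k::field_char_0"
  assumes "finite E" "finite M" "\<forall>m\<in>M. set_mset m \<subseteq> E"
    and "\<And>s. (\<Sum>m\<in>M. c m * prod_mset (image_mset s m)) = 0"
    and "m \<in> M"
  shows "c m = 0"
  using assms
proof (induction E arbitrary: M c m rule: finite_induct)
  case empty
  then have "M = {{#}}" by auto
  then show ?case using empty.prems(3) \<open>m \<in> M\<close> by simp
next
  case (insert e E)
  let ?\<phi> = "filter_mset (\<lambda>a. a \<noteq> e)"
  let ?n = "count m e"
  define N where "N = {m' \<in> M. count m' e = ?n}"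
  define c' where "c' m' = c (m' + replicate_mset ?n e)" for m'
  have split: "?\<phi> m' + replicate_mset ?n e = m'" if "m' \<in> N" for m'
    using that multiset_partition[of m' "\<lambda>a. a = e"]
    by (simp add: N_def filter_eq_replicate_mset add.commute)
  have inj: "inj_on ?\<phi> N" by (rule inj_onI) (metis split)
  have "c' (?\<phi> m) = 0"
  proof (rule insert.IH[of "?\<phi> ` N"])
    show "finite (?\<phi> ` N)" using insert.prems(1) by (simp add: N_def)
    show "\<forall>m'\<in>?\<phi> ` N. set_mset m' \<subseteq> E" using insert.prems(2) by (auto simp: N_def)
    show "?\<phi> m \<in> ?\<phi> ` N" using insert.prems(4) by (auto simp: N_def)
    fix s
    define q where "q = (\<Sum>m\<in>M. monom (c m * prod_mset (image_mset s (?\<phi> m))) (count m e))"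
    have "poly q t = 0" for t
      using insert.prems(3)[of "s(e := t)"] unfolding prod_mset_fun_upd
      by (simp add: q_def poly_sum poly_monom mult.assoc mult.left_commute mult.commute)
    then have "q = 0" using poly_all_0_iff_0 by blast
    then have "0 = coeff q ?n" by simp
    also have "\<dots> = (\<Sum>m\<in>N. c m * prod_mset (image_mset s (?\<phi> m)))"
      using insert.prems(1) by (simp add: q_def coeff_sum N_def sum.If_cases sum.inter_filter)
    also have "\<dots> = (\<Sum>m'\<in>?\<phi> ` N. c' m' * prod_mset (image_mset s m'))"
      unfolding sum.reindex[OF inj] by (rule sum.cong) (simp_all add: c'_def split)
    finally show "(\<Sum>m'\<in>?\<phi> ` N. c' m' * prod_mset (image_mset s m')) = 0" ..
  qed
  then show ?case using split[of m] insert.prems(4) by (simp add: c'_def N_def)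
qed

lemma monomial_coefficients_zero:
  fixes a :: "'i \<Rightarrow> 'k::field_char_0" and \<mu> :: "'i \<Rightarrow> 'a multiset"
  assumes "finite I" and "\<And>s. (\<Sum>x\<in>I. a x * prod_mset (image_mset s (\<mu> x))) = 0"
  shows "(\<Sum>x | x \<in> I \<and> \<mu> x = m. a x) = 0"
proof (cases "m \<in> \<mu> ` I")
  case True
  define c where "c m = (\<Sum>x | x \<in> I \<and> \<mu> x = m. a x)" for m
  have "c m = 0"
  proof (rule monomials_independent[OF _ _ _ _ True])
    show "finite (\<Union>m\<in>\<mu> ` I. set_mset m)" "finite (\<mu> ` I)" using assms(1) by auto
    show "\<forall>m\<in>\<mu> ` I. set_mset m \<subseteq> (\<Union>m\<in>\<mu> ` I. set_mset m)" by auto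
    show "(\<Sum>m\<in>\<mu> ` I. c m * prod_mset (image_mset s m)) = 0" for s
    proof -
      have "0 = (\<Sum>x\<in>I. a x * prod_mset (image_mset s (\<mu> x)))" using assms(2) by simp
      also have "\<dots> = (\<Sum>m\<in>\<mu> ` I. \<Sum>x | x \<in> I \<and> \<mu> x = m. a x * prod_mset (image_mset s (\<mu> x)))"
        by (rule sum.image_gen[OF assms(1)])
      also have "\<dots> = (\<Sum>m\<in>\<mu> ` I. c m * prod_mset (image_mset s m))"
        by (rule sum.cong) (simp_all add: c_def sum_distrib_right)
      finally show ?thesis ..
    qed
  qed
  then show ?thesis by (simp add: c_def)
next
  case False
  then have "{x. x \<in> I \<and> \<mu> x = m} = {}" by auto
  then show ?thesis by (simp only: sum.empty)
qed

section \<open>Evaluating words at a diagonal matrix\<close>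

text \<open>
  Each \<open>x\<close> is recorded by the number of letters \<open>y\<close> before it, so this list is the commutative monomial
  attached to the word, with the variable \<open>z\<^sub>k\<close> repeated as often as \<open>x\<close> occurs between consecutive letters \<open>y\<close>.
\<close>

primrec x_positions :: "letter list \<Rightarrow> nat list" where
  "x_positions [] = []"
| "x_positions (l # w) = (case l of Lx \<Rightarrow> 0 # x_positions w | Ly \<Rightarrow> map Suc (x_positions w))"

abbreviation y_count :: "letter list \<Rightarrow> nat" where
  "y_count w \<equiv> count_list w Ly"

lemma length_x_positions: "length (x_positions w) + y_count w = length w"
  by (induction w) (auto split: letter.split)

lemma x_positions_le: "k \<in> set (x_positions w) \<Longrightarrow> k \<le> y_count w"
  by (induction w arbitrary: k) (auto split: letter.splits)

lemma sorted_x_positions: "sorted (x_positions w)"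
  by (induction w) (auto split: letter.split simp: sorted_map sorted_wrt_map)

lemma x_positions_inject:
  "x_positions v = x_positions w \<Longrightarrow> y_count v = y_count w \<Longrightarrow> v = w"
proof (induction v arbitrary: w)
  case Nil
  then show ?case using length_x_positions[of w] by auto
next
  case (Cons l v)
  then obtain k w' where w: "w = k # w'"
    using length_x_positions[of "l # v"] length_x_positions[of w] by (cases w) auto
  show ?case
    using Cons.prems Cons.IH[of w'] unfolding w
    by (cases l; cases k) (auto simp: map_eq_Cons_conv dest: sym)
qed

lemma x_positions_inject_mset:
  assumes "mset (x_positions v) = mset (x_positions w)" "y_count v = y_count w"
  shows "v = w"
proof -
  have "x_positions v = sort (x_positions w)"
    by (rule properties_for_sort[OF assms(1) sorted_x_positions, symmetric])
  then show ?thesis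
    using assms(2) by (intro x_positions_inject) (simp_all add: sorted_sort_id sorted_x_positions)
qed

definition diag :: "('n \<Rightarrow> 'k) \<Rightarrow> 'k::field^'n^'n" where
  "diag t = (\<chi> i j. if i = j then t i else 0)"

definition paths :: "nat \<Rightarrow> 'n \<Rightarrow> 'n \<Rightarrow> 'n list set" where
  "paths b i j = {\<tau>. length \<tau> = Suc b \<and> hd \<tau> = i \<and> last \<tau> = j}"

lemma finite_paths [simp]: "finite (paths b i (j :: 'n::finite))"
proof (rule finite_subset)
  show "paths b i j \<subseteq> {\<tau>. set \<tau> \<subseteq> UNIV \<and> length \<tau> = Suc b}" by (auto simp: paths_def)
qed (rule finite_lists_length_eq, simp)

lemma sum_paths_Suc:
  fixes g :: "'n::finite list \<Rightarrow> 'k::comm_monoid_add"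
  shows "(\<Sum>\<tau>\<in>paths (Suc b) i j. g \<tau>) = (\<Sum>l\<in>UNIV. \<Sum>\<tau>\<in>paths b l j. g (i # \<tau>))"
proof -
  have "(\<Sum>l\<in>UNIV. \<Sum>\<tau>\<in>paths b l j. g (i # \<tau>))
      = (\<Sum>(l, \<tau>)\<in>(SIGMA l:UNIV. paths b l j). g (i # \<tau>))"
    by (rule sum.Sigma) auto
  also have "\<dots> = (\<Sum>\<tau>\<in>paths (Suc b) i j. g \<tau>)"
    by (rule sum.reindex_bij_witness[of _ "\<lambda>\<tau>. (hd (tl \<tau>), tl \<tau>)" "\<lambda>(l, \<tau>). i # \<tau>"])
      (auto simp: paths_def length_Suc_conv)
  finally show ?thesis ..
qed

text \<open>
  Expanding the matrix product, only the letters \<open>y\<close> move along an edge; a letter \<open>x\<close> multiplies by the diagonal entry at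
  the current vertex, which is the one reached after as many steps as there were letters \<open>y\<close> before it.
\<close>

lemma word_eval_diag:
  fixes B :: "'k::field^'n::finite^'n"
  shows "word_eval (diag t) B w $ i $ j = (\<Sum>\<tau>\<in>paths (y_count w) i j.
     prod_list (map (\<lambda>k. t (\<tau> ! k)) (x_positions w)) * prod_list (map (\<lambda>(a, b). B $ a $ b) (edges \<tau>)))"
proof (induction w arbitrary: i)
  case Nil
  have "paths 0 i j = (if i = j then {[i]} else {})"
    by (auto simp: paths_def length_Suc_conv)
  then show ?case by (simp add: mat_def)
next
  case (Cons l w)
  show ?case
  proof (cases l)
    case Lx
    have "(diag t ** X) $ i $ j = t i * X $ i $ j" for X
      by (simp add: diag_def matrix_matrix_mult_def if_distrib[of "\<lambda>x. x * _"] cong: if_cong)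
    moreover have "\<tau> ! 0 = i" if "\<tau> \<in> paths b i j" for \<tau> b
      using that by (auto simp: paths_def length_Suc_conv)
    ultimately show ?thesis using Cons.IH[of i] Lx
      by (simp add: sum_distrib_left mult.assoc cong: sum.cong)
  next
    case Ly
    have "edges (i # \<tau>) = (i, l) # edges \<tau>" if "\<tau> \<in> paths b l j" for \<tau> l b
      using that by (auto simp: paths_def edges_Cons length_Suc_conv)
    then show ?thesis using Cons.IH Ly
      by (simp add: matrix_matrix_mult_def sum_paths_Suc sum_distrib_left comp_def
          mult.left_commute cong: sum.cong)
  qed
qed

text \<open>
  The commutative polynomial attached to the part of degree \<open>b\<close> in \<open>y\<close> of \<open>\<Sum>w\<in>W. c w * w\<close>.
\<close>

definition path_poly :: "letter list set \<Rightarrow> (letter list \<Rightarrow> 'k::comm_ring_1) \<Rightarrow> nat \<Rightarrow> (nat \<Rightarrow> 'k) \<Rightarrow> 'k" where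
  "path_poly W c b z = (\<Sum>w | w \<in> W \<and> y_count w = b. c w * prod_list (map z (x_positions w)))"

lemma path_poly_cong:
  assumes "\<And>k. k \<le> b \<Longrightarrow> y k = z k"
  shows "path_poly W c b y = path_poly W c b z"
proof -
  have eq: "map y (x_positions w) = map z (x_positions w)" if "y_count w = b" for w
    using assms x_positions_le that by auto
  show ?thesis
    unfolding path_poly_def by (rule sum.cong[OF refl]) (metis (mono_tags) eq mem_Collect_eq)
qed

lemma poly_below_path_poly:
  fixes c :: "letter list \<Rightarrow> 'k::field"
  assumes "finite W" "\<forall>w\<in>W. length w \<le> d"
  shows "poly_below (Suc d - b) (path_poly W c b)"
  unfolding path_poly_def[abs_def]
proof (rule poly_below_sum)
  fix w
  assume w: "w \<in> {w. w \<in> W \<and> y_count w = b}"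
  then have "Suc (length (x_positions w)) \<le> Suc d - b"
    using assms(2) length_x_positions[of w] by fastforce
  then show "poly_below (Suc d - b) (\<lambda>z. c w * prod_list (map z (x_positions w)))"
    by (intro poly_below_scale) (rule poly_below_mono[OF poly_below_monomial])
qed (use assms(1) in simp)

text \<open>
  Words with \<open>b\<close> letters \<open>y\<close> correspond to distinct monomials, so no cancellation between them is possible.
\<close>

lemma path_poly_eq_0:
  fixes c :: "letter list \<Rightarrow> 'k::field_char_0"
  assumes W: "finite W" and p: "\<And>z. path_poly W c b z = 0" and w: "w \<in> W" "y_count w = b"
  shows "c w = 0"
proof -
  let ?I = "{v. v \<in> W \<and> y_count v = b}"
  have "(\<Sum>v | v \<in> ?I \<and> mset (x_positions v) = mset (x_positions w). c v) = 0"
    using W p by (intro monomial_coefficients_zero)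
      (simp_all add: path_poly_def flip: mset_map prod_mset_prod_list)
  moreover have "{v. v \<in> ?I \<and> mset (x_positions v) = mset (x_positions w)} = {w}"
    using w x_positions_inject_mset by auto
  ultimately show ?thesis by simp
qed

text \<open>
  The entries of \<open>B\<close> are independent variables, and the monomial belonging to a walk determines exactly its multiset of
  edges. The entry \<open>(i, j)\<close> therefore splits into one equation for each multigraph, for arbitrary diagonal entries \<open>t\<close>.
\<close>

lemma path_poly_balanced:
  fixes c :: "letter list \<Rightarrow> 'k::field_char_0"
  assumes W: "finite W"
    and off: "\<And>(A :: 'k^4^4) B i j. i \<noteq> j \<Longrightarrow> (\<Sum>w\<in>W. c w * word_eval A B w $ i $ j) = 0"
  shows "balanced b (path_poly W c b)"
  unfolding balanced_def
proof (intro allI impI)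
  fix \<sigma> :: "nat list" and u :: "nat \<Rightarrow> 'k"
  assume len: "length \<sigma> = Suc b" and ends: "hd \<sigma> \<noteq> last \<sigma>" and card: "card (set \<sigma>) \<le> 4"
  have ne: "\<sigma> \<noteq> []" using len by auto
  have b: "2 \<le> length \<sigma>" using len ends by (cases b) (auto simp: length_Suc_conv)
  have "card (set \<sigma>) \<le> card (UNIV :: 4 set)" using card by simp
  then obtain e :: "nat \<Rightarrow> 4" where e: "inj_on e (set \<sigma>)"
    using card_le_inj[of "set \<sigma>" "UNIV :: 4 set"] by auto
  define t where "t = (\<lambda>v. u (inv_into (set \<sigma>) e v))"
  define i where "i = e (hd \<sigma>)"
  define j where "j = e (last \<sigma>)"
  have ij: "i \<noteq> j"
    using ends e ne unfolding i_def j_def by (auto simp: inj_on_eq_iff)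
  define I where "I = (SIGMA w:W. paths (y_count w) i j)"
  have fin: "finite I" using W by (simp add: I_def)
  define a where "a = (\<lambda>(w, \<tau>). c w * prod_list (map (\<lambda>k. t (\<tau> ! k)) (x_positions w)))"
  define \<mu> where "\<mu> = (\<lambda>(w :: letter list, \<tau> :: 4 list). mset (edges \<tau>))"
  define m where "m = mset (edges (map e \<sigma>))"
  have "(\<Sum>x | x \<in> I \<and> \<mu> x = m. a x) = 0"
  proof (rule monomial_coefficients_zero[OF fin])
    fix s :: "4 \<times> 4 \<Rightarrow> 'k"
    define B :: "'k^4^4" where "B = (\<chi> k l. s (k, l))"
    have "0 = (\<Sum>w\<in>W. c w * word_eval (diag t) B w $ i $ j)" using off[OF ij] by simp
    also have "\<dots> = (\<Sum>w\<in>W. \<Sum>\<tau>\<in>paths (y_count w) i j. a (w, \<tau>) * prod_mset (image_mset s (\<mu> (w, \<tau>))))"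
      by (simp add: word_eval_diag sum_distrib_left a_def \<mu>_def B_def mult.assoc
          flip: mset_map prod_mset_prod_list)
    also have "\<dots> = (\<Sum>x\<in>I. a x * prod_mset (image_mset s (\<mu> x)))"
      unfolding I_def using W by (subst sum.Sigma) (auto intro!: sum.cong)
    finally show "(\<Sum>x\<in>I. a x * prod_mset (image_mset s (\<mu> x))) = 0" ..
  qed
  also have "{x. x \<in> I \<and> \<mu> x = m} = {w. w \<in> W \<and> y_count w = b} \<times> retracings (map e \<sigma>)"
  proof -
    have "b = size m" using len by (simp add: m_def)
    then have "y_count w = b" if "\<tau> \<in> paths (y_count w) i j" "mset (edges \<tau>) = m" for w and \<tau> :: "4 list"
      using that by (auto simp: paths_def)
    then show ?thesis
      using len ne by (auto simp: I_def \<mu>_def paths_def retracings_def m_def i_def j_def hd_map last_map)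
  qed
  also have "sum a \<dots> = (\<Sum>\<tau>\<in>retracings (map e \<sigma>). path_poly W c b (\<lambda>k. t (\<tau> ! k)))"
    unfolding path_poly_def sum.cartesian_product[symmetric] a_def
    by (simp add: sum.swap[of _ "retracings (map e \<sigma>)"])
  also have "\<dots> = (\<Sum>\<tau>\<in>retracings \<sigma>. path_poly W c b (\<lambda>k. t (map e \<tau> ! k)))"
    by (rule sum.reindex_bij_betw[OF bij_betw_retracings[OF e b], symmetric])
  also have "\<dots> = (\<Sum>\<tau>\<in>retracings \<sigma>. path_poly W c b (spread \<tau> u))"
  proof (rule sum.cong[OF refl], rule path_poly_cong)
    fix \<tau> k
    assume \<tau>: "\<tau> \<in> retracings \<sigma>" and "k \<le> b"
    then have k: "k < length \<tau>" using len by (simp add: retracings_def)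
    then have "\<tau> ! k \<in> set \<sigma>" using set_retracing[OF \<tau> b] nth_mem by blast
    then show "t (map e \<tau> ! k) = spread \<tau> u k"
      using k e by (simp add: t_def spread_def)
  qed
  finally show "(\<Sum>\<tau>\<in>retracings \<sigma>. path_poly W c b (spread \<tau> u)) = 0" .
qed

section \<open>Polynomials with scalar values\<close>

definition scalar_valued :: "letter list set \<Rightarrow> (letter list \<Rightarrow> 'k::field) \<Rightarrow> bool" where
  "scalar_valued W c \<longleftrightarrow> (\<forall>(A :: 'k^4^4) B i j.
     (i \<noteq> j \<longrightarrow> (\<Sum>w\<in>W. c w * word_eval A B w $ i $ j) = 0) \<and>
     (\<Sum>w\<in>W. c w * word_eval A B w $ i $ i) = (\<Sum>w\<in>W. c w * word_eval A B w $ j $ j))"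

lemma mixed_coefficient_zero:
  fixes c :: "letter list \<Rightarrow> 'k::field_char_0"
  assumes W: "finite W" "\<forall>w\<in>W. length w \<le> 12" and sv: "scalar_valued W c"
    and w: "w \<in> W" "1 \<le> y_count w" "y_count w \<le> 6"
  shows "c w = 0"
proof (rule path_poly_eq_0[OF W(1) _ w(1) refl])
  let ?b = "y_count w"
  fix z :: "nat \<Rightarrow> 'k"
  have "balanced ?b (path_poly W c ?b)"
    using sv by (intro path_poly_balanced[OF W(1)]) (simp add: scalar_valued_def)
  moreover have "poly_below (13 - ?b) (path_poly W c ?b)"
    using poly_below_path_poly[OF W] by simp
  ultimately have "vanishes (path_poly W c ?b) [0..<Suc ?b]"
    using w(2,3) by (rule balanced_imp_vanishes)
  then have "path_poly W c ?b (spread [0..<Suc ?b] z) = 0" by (simp add: vanishes_def)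
  moreover have "path_poly W c ?b (spread [0..<Suc ?b] z) = path_poly W c ?b z"
    by (rule path_poly_cong) (simp add: spread_def nth_append del: upt_Suc)
  ultimately show "path_poly W c ?b z = 0" by simp
qed

lemma diag_mult: "diag s ** diag t = diag (\<lambda>i. s i * t i)"
  by (simp add: diag_def matrix_matrix_mult_def vec_eq_iff if_distrib[of "\<lambda>x. x * _"] cong: if_cong)

lemma word_eval_diag_0:
  "word_eval (diag t) 0 w = (if y_count w = 0 then diag (\<lambda>i. t i ^ length w) else 0)"
  by (induction w) (simp_all add: diag_mult diag_def[of "\<lambda>_. 1"] mat_def split: letter.split)

text \<open>
  At \<open>y = 0\<close> and diagonal \<open>x\<close> only powers of \<open>x\<close> survive. Equality of the diagonal entries says that the univariate polynomial
  \<open>q\<close> they form takes the same value everywhere.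
\<close>

lemma power_coefficient_zero:
  fixes c :: "letter list \<Rightarrow> 'k::field_char_0"
  assumes W: "finite W" and sv: "scalar_valued W c"
    and w: "w \<in> W" "w \<noteq> []" "y_count w = 0"
  shows "c w = 0"
proof -
  define q where "q = (\<Sum>v | v \<in> W \<and> y_count v = 0. monom (c v) (length v))"
  have entry: "(\<Sum>v\<in>W. c v * word_eval (diag t) 0 v $ i $ i) = poly q (t i)" for t :: "4 \<Rightarrow> 'k" and i
  proof -
    have "(\<Sum>v\<in>W. c v * word_eval (diag t) 0 v $ i $ i)
        = (\<Sum>v\<in>W. if y_count v = 0 then c v * t i ^ length v else 0)"
      by (rule sum.cong) (simp_all add: word_eval_diag_0, simp_all add: diag_def)
    then show ?thesis
      using W by (simp add: q_def poly_sum poly_monom sum.inter_filter if_distrib[of "\<lambda>p. poly p _"] cong: if_cong)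
  qed
  have "poly q x = poly q 0" for x
  proof -
    let ?t = "\<lambda>i :: 4. if i = 0 then x else 0"
    have "(\<Sum>v\<in>W. c v * word_eval (diag ?t) 0 v $ 0 $ 0) = (\<Sum>v\<in>W. c v * word_eval (diag ?t) 0 v $ 1 $ 1)"
      using sv unfolding scalar_valued_def by blast
    then show ?thesis unfolding entry by simp
  qed
  then have "poly q x = poly [:poly q 0:] x" for x by simp
  then have "q = [:poly q 0:]" using poly_eq_poly_eq_iff[of q "[:poly q 0:]"] by blast
  moreover have "coeff [:poly q 0:] (length w) = 0" using w(2) by (cases w) simp_all
  ultimately have "coeff q (length w) = 0" by metis
  moreover have "coeff q (length w) = (\<Sum>v | v \<in> W \<and> y_count v = 0. if v = w then c v else 0)"
    unfolding q_def coeff_sum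
  proof (rule sum.cong[OF refl])
    fix v
    assume v: "v \<in> {v. v \<in> W \<and> y_count v = 0}"
    have "v = w" if "length v = length w"
    proof -
      have x: "v = replicate (length v) Lx" if "y_count v = 0" for v
        using that by (induction v) (auto split: if_splits intro: letter.exhaust)
      show ?thesis using x[of v] x[of w] v w(3) that by simp
    qed
    then show "coeff (monom (c v) (length v)) (length w) = (if v = w then c v else 0)" by auto
  qed
  ultimately show ?thesis using W w by simp
qed

definition swap_letter :: "letter \<Rightarrow> letter" where
  "swap_letter l = (case l of Lx \<Rightarrow> Ly | Ly \<Rightarrow> Lx)"

abbreviation swap_word :: "letter list \<Rightarrow> letter list" where
  "swap_word \<equiv> map swap_letter"

lemma swap_letter_swap_letter [simp]: "swap_letter (swap_letter l) = l"
  by (cases l) (simp_all add: swap_letter_def)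

lemma swap_letter_comp [simp]: "swap_letter \<circ> swap_letter = id"
  by (simp add: fun_eq_iff)

lemma swap_word_swap_word: "swap_word (swap_word w) = w"
  by simp

lemma word_eval_swap_word: "word_eval A B (swap_word w) = word_eval B A w"
  by (induction w) (auto simp: swap_letter_def split: letter.split)

lemma y_count_swap_word: "y_count (swap_word w) + y_count w = length w"
  by (induction w) (auto simp: swap_letter_def split: letter.split)

lemma scalar_valued_swap:
  assumes "scalar_valued W c"
  shows "scalar_valued (swap_word ` W) (\<lambda>w. c (swap_word w))"
proof -
  have "inj_on swap_word W" by (rule inj_onI) (metis swap_word_swap_word)
  then have "(\<Sum>w\<in>swap_word ` W. c (swap_word w) * word_eval A B w $ i $ j)
      = (\<Sum>w\<in>W. c w * word_eval B A w $ i $ j)" for A B :: "'a^4^4" and i j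
    by (simp add: sum.reindex word_eval_swap_word)
  then show ?thesis using assms by (simp add: scalar_valued_def)
qed

text \<open>
  In a word of length at most 12 one of the letters occurs at most six times.
\<close>

lemma scalar_valued_coefficient_zero:
  fixes c :: "letter list \<Rightarrow> 'k::field_char_0"
  assumes W: "finite W" "\<forall>w\<in>W. length w \<le> 12" and sv: "scalar_valued W c"
    and w: "w \<in> W" "w \<noteq> []"
  shows "c w = 0"
proof -
  have half: "c w = 0"
    if "finite W" "\<forall>w\<in>W. length w \<le> 12" "scalar_valued W c" "w \<in> W" "w \<noteq> []" "y_count w \<le> 6"
    for W w and c :: "letter list \<Rightarrow> 'k"
    using mixed_coefficient_zero[OF that(1-4)] power_coefficient_zero[OF that(1,3,4,5)] that(6)
    by (cases "y_count w = 0") auto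
  show ?thesis
  proof (cases "y_count w \<le> 6")
    case True
    then show ?thesis using half assms by blast
  next
    case False
    moreover have "length w \<le> 12" using W(2) w(1) by blast
    ultimately have "y_count (swap_word w) \<le> 6" using y_count_swap_word[of w] by linarith
    then have "c (swap_word (swap_word w)) = 0"
      using W w by (intro half[OF _ _ scalar_valued_swap[OF sv], of "swap_word w"]) auto
    then show ?thesis by simp
  qed
qed

text \<open>
  Commute with the matrix units.
\<close>

lemma mat_center_scalar:
  assumes "C \<in> (mat_center :: ('k::field^'n::finite^'n) set)"
  shows "i \<noteq> j \<Longrightarrow> C $ i $ j = 0" and "C $ i $ i = C $ j $ j"
proof -
  define E :: "'n \<Rightarrow> 'n \<Rightarrow> 'k^'n^'n" where "E a b = (\<chi> r s. if r = a \<and> s = b then 1 else 0)" for a b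
  have l: "(C ** E a b) $ r $ s = (if s = b then C $ r $ a else 0)" for a b r s
    by (simp add: E_def matrix_matrix_mult_def if_distrib[of "\<lambda>x. _ * x"] cong: if_cong conj_cong)
  have r: "(E a b ** C) $ r $ s = (if r = a then C $ b $ s else 0)" for a b r s
    by (simp add: E_def matrix_matrix_mult_def if_distrib[of "\<lambda>x. x * _"] cong: if_cong conj_cong)
  have c: "C ** E a b = E a b ** C" for a b using assms by (simp add: mat_center_def)
  show "C $ i $ j = 0" if "i \<noteq> j"
    using c[of j j] l[of j j i j] r[of j j i j] that by simp
  show "C $ i $ i = C $ j $ j"
    using c[of i j] l[of i j i j] r[of i j i j] by simp
qed

lemma central_values_constant:
  fixes f :: "'k::field_char_0 free_alg2"
  assumes cen: "\<And>A B :: 'k^4^4. poly_eval f A B \<in> mat_center" and deg: "total_degree f \<le> 12"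
  shows "Poly_Mapping.keys f \<subseteq> {[]}"
proof
  let ?W = "Poly_Mapping.keys f" and ?c = "Poly_Mapping.lookup f"
  have entry: "poly_eval f A B $ i $ j = (\<Sum>w\<in>?W. ?c w * word_eval A B w $ i $ j)"
    for A B :: "'k^4^4" and i j
    by (simp add: poly_eval_def mat_mult_entry)
  have sv: "scalar_valued ?W ?c"
    unfolding scalar_valued_def entry[symmetric] by (intro allI conjI impI) (erule mat_center_scalar(1)[OF cen], rule mat_center_scalar(2)[OF cen])
  have "length w \<le> total_degree f" if "w \<in> ?W" for w
    unfolding total_degree_def using that by (intro Max_ge) auto
  then have len: "\<forall>w\<in>?W. length w \<le> 12" using deg by fastforce
  fix w
  assume w: "w \<in> ?W"
  then have "?c w \<noteq> 0" by (simp add: in_keys_iff)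
  then have "w = []"
    using scalar_valued_coefficient_zero[OF finite_keys len sv w] by blast
  then show "w \<in> {[]}" by simp
qed

theorem mainTheorem1:
  shows "(\<nexists>c :: 'k::field_char_0 free_alg2.
            central_polynomial TYPE(4) c \<and> 1 \<le> total_degree c \<and> total_degree c \<le> 12) \<and>
         (\<nexists>f :: 'k free_alg2.
            polynomial_identity TYPE(4) f \<and> f \<noteq> 0 \<and> total_degree f \<le> 12)"
proof (intro conjI notI; elim exE conjE)
  fix c :: "'k free_alg2"
  assume c: "central_polynomial TYPE(4) c" and deg: "1 \<le> total_degree c" "total_degree c \<le> 12"
  have "Poly_Mapping.keys c \<subseteq> {[]}"
    using c deg(2) by (intro central_values_constant) (simp_all add: central_polynomial_def)
  then have "length ` Poly_Mapping.keys c \<subseteq> {0}" by auto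
  then have "insert 0 (length ` Poly_Mapping.keys c) = {0}" by blast
  then have "total_degree c = 0" unfolding total_degree_def by (simp only: Max_singleton)
  with deg(1) show False by simp
next
  fix f :: "'k free_alg2"
  assume f: "polynomial_identity TYPE(4) f" "f \<noteq> 0" and deg: "total_degree f \<le> 12"
  have zero: "poly_eval f A B = 0" for A B :: "'k^4^4"
    using f(1) by (simp add: polynomial_identity_def)
  have "0 \<in> (mat_center :: ('k^4^4) set)"
    by (simp add: mat_center_def matrix_matrix_mult_def zero_vec_def)
  then have "Poly_Mapping.keys f \<subseteq> {[]}"
    using deg by (intro central_values_constant) (simp_all add: zero)
  moreover have "Poly_Mapping.keys f \<noteq> {}" using f(2) by simp
  ultimately have k: "Poly_Mapping.keys f = {[]}" by blast
  have "(0 :: 'k) = poly_eval f 0 (0 :: 'k^4^4) $ 0 $ 0" by (simp add: zero)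
  also have "\<dots> = Poly_Mapping.lookup f []"
    by (simp add: poly_eval_def k mat_mult_entry) (simp add: mat_def)
  finally show False using k in_keys_iff[of "[]" f] by simp
qed

end
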